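(* Let $Y$ be a real topological vector space, $D\subset Y$ a non-trivial pointed closed convex cone, and $F\subset Y$ with $F\subseteq a+D$ for some $a\in Y$. Then $\operatorname{Eff}(F,D)=\{a\}$ in the case $a\in F$, and otherwise $$\operatorname{Eff}(F,D)=\{y^0\in F\mid\exists k\in D\setminus\{0\}:\ y^0\in\operatorname{dom}\varphi_{a-D,k}\ \text{ and }\ \varphi_{a-D,k}(y^0)<\varphi_{a-D,k}(y)\ \text{ for all } y\in(F\cap\operatorname{dom}\varphi_{a-D,k})\setminus\{y^0\}\}.$$ For $y^0\in\operatorname{Eff}(F,D)$ (in the case $a\notin F$), one can choose $k=y^0-a$, which results in $\varphi_{a-D,k}(y^0)\le1<\varphi_{a-D,k}(y)$ for all $y\in(F\cap\operatorname{dom}\varphi_{a-D,k})\setminus\{y^0\}$, where $\varphi_{a-D,k}$ is proper.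
   Context: $\operatorname{Eff}(F,D):=\{y^0\in F\mid F\cap(y^0-D)\subseteq\{y^0\}\}$. A set $C\subseteq Y$ is a cone if $\mathbb{R}_+C\subseteq C$ with $\mathbb{R}_+=\{x\in\mathbb{R}\mid x\ge0\}$; it is non-trivial if $C\neq\emptyset$, $C\neq\{0\}$, $C\neq Y$; it is pointed if $C\cap(-C)=\{0\}$. For $a\in Y$ and $k\in D\setminus\{0\}$, $\varphi_{a-D,k}(y):=\inf\{t\in\mathbb{R}\mid y\in a-D+tk\}$ for $y\in Y$, where $\inf\emptyset:=\nu$ is a symbol outside the extended reals marking infeasibility; $\operatorname{dom}\varphi_{a-D,k}:=\{y\in Y\mid\varphi_{a-D,k}(y)\in\mathbb{R}\cup\{-\infty\}\}=a-D+\mathbb{R}k$. $\varphi_{a-D,k}$ is called proper if $\operatorname{dom}\varphi_{a-D,k}\neq\emptyset$ and $\varphi_{a-D,k}(y)\in\mathbb{R}$ for all $y\in\operatorname{dom}\varphi_{a-D,k}$. *)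

theory Defs
  imports "HOL-Analysis.Analysis"
begin

text \<open>The vector topology is not assumed to be Hausdorff.\<close>

class real_topological_vector = real_vector + topological_ab_group_add +
  assumes tendsto_scaleR_Pair:
    "LIM p (nhds c \<times>\<^sub>F nhds x). fst p *\<^sub>R snd p :> nhds (c *\<^sub>R x)"

instance real_normed_vector \<subseteq> real_topological_vector
proof
  fix c :: real and x :: 'a
  have "((\<lambda>p. fst p *\<^sub>R snd p) \<longlongrightarrow> c *\<^sub>R x) (nhds c \<times>\<^sub>F nhds x)"
    by (intro tendsto_scaleR filterlim_fst filterlim_snd)
  then show "LIM p (nhds c \<times>\<^sub>F nhds x). fst p *\<^sub>R snd p :> nhds (c *\<^sub>R x)" .
qed

definition translate_neg :: "'a::group_add \<Rightarrow> 'a set \<Rightarrow> 'a set" where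
  "translate_neg a D = (\<lambda>d. a - d) ` D"

definition Eff :: "'a::group_add set \<Rightarrow> 'a set \<Rightarrow> 'a set" where
  "Eff F D = {y0 \<in> F. F \<inter> translate_neg y0 D \<subseteq> {y0}}"

definition nontrivial_cone :: "'a::real_vector set \<Rightarrow> bool" where
  "nontrivial_cone C \<longleftrightarrow> cone C \<and> C \<noteq> {} \<and> C \<noteq> {0} \<and> C \<noteq> UNIV"

definition pointed :: "'a::real_vector set \<Rightarrow> bool" where
  "pointed C \<longleftrightarrow> C \<inter> uminus ` C = {0}"

text \<open>
  The translation functional takes its values in the extended reals together with one further
  symbol for the infimum of the empty set; that symbol is \<open>None\<close>. In particular the infimum of
  the empty set is not \<open>\<infinity>\<close> here. The functional of \<open>a - D\<close> is \<open>phi (translate_neg a D) k\<close>.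
\<close>

definition phi :: "'a::real_vector set \<Rightarrow> 'a \<Rightarrow> 'a \<Rightarrow> ereal option" where
  "phi A k y =
    (let T = {t::real. y \<in> (\<lambda>z. z + t *\<^sub>R k) ` A}
     in if T = {} then None else Some (INF t\<in>T. ereal t))"

definition effdom :: "('a \<Rightarrow> ereal option) \<Rightarrow> 'a set" where
  "effdom f = {y. f y \<in> Some ` (range ereal \<union> {-\<infinity>})}"

definition proper_fun :: "('a \<Rightarrow> ereal option) \<Rightarrow> bool" where
  "proper_fun f \<longleftrightarrow> effdom f \<noteq> {} \<and> (\<forall>y\<in>effdom f. f y \<in> Some ` range ereal)"

lemma effdom_phi: "effdom (phi A k) = {z + t *\<^sub>R k | z t. z \<in> A}"
proof (intro set_eqI iffI)
  fix y assume "y \<in> effdom (phi A k)"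
  then show "y \<in> {z + t *\<^sub>R k | z t. z \<in> A}"
    by (auto simp: effdom_def phi_def Let_def split: if_splits)
next
  fix y assume "y \<in> {z + t *\<^sub>R k | z t. z \<in> A}"
  then obtain z t where zt: "z \<in> A" "y = z + t *\<^sub>R k" by blast
  define T where "T = {t::real. y \<in> (\<lambda>z. z + t *\<^sub>R k) ` A}"
  have t: "t \<in> T" using zt by (auto simp: T_def)
  then have "(INF t\<in>T. ereal t) \<le> ereal t" by (rule INF_lower)
  then have "(INF t\<in>T. ereal t) \<in> range ereal \<union> {-\<infinity>}"
    by (cases "INF t\<in>T. ereal t") auto
  moreover have "phi A k y = Some (INF t\<in>T. ereal t)"
    using t by (auto simp: phi_def T_def Let_def)
  ultimately show "y \<in> effdom (phi A k)" by (auto simp: effdom_def)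
qed

end

theory Submission
  imports Defs
begin

text \<open>
  Write \<open>\<phi>\<close> for the functional of \<open>a - D\<close> in a direction \<open>k \<in> D\<close>. Since \<open>D\<close> is a convex cone
  containing \<open>k\<close>, the set of all \<open>t\<close> with \<open>y \<in> a - D + tk\<close> is closed upwards, and since \<open>D\<close> is
  closed, it contains its infimum when that is finite. So the sublevel set of \<open>\<phi>\<close> of height \<open>t\<close> is
  exactly \<open>a - D + tk\<close> (lemma \<open>phi_le_iff\<close>), and everything follows from this description.

  For a direction \<open>k = y0 - a\<close> the sublevel set of height \<open>1\<close> is \<open>y0 - D\<close>. Efficiency
  of \<open>y0\<close> says that \<open>F\<close> meets this set in \<open>y0\<close> only, so \<open>\<phi>\<close> exceeds \<open>1\<close> at all other points of \<open>F\<close>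
  in its domain, while \<open>\<phi> y0 \<le> 1\<close>. Conversely, \<open>\<phi>\<close> is monotone with respect to \<open>D\<close> for every direction
  (lemma \<open>phi_mono\<close>), so a point of \<open>F \<inter> (y0 - D)\<close> is also in the domain and has a
  value at most \<open>\<phi> y0\<close>; hence a strict minimizer \<open>y0\<close> must be efficient. Properness follows
  from pointedness: a value \<open>-\<infinity>\<close> would put a whole line of direction \<open>k\<close> into \<open>D\<close>, and
  then \<open>- k \<in> D\<close> (lemma \<open>closed_cone_uminus_direction\<close>).

  If \<open>a \<in> F\<close>, then \<open>a\<close> lies in \<open>y - D\<close> for every \<open>y \<in> F\<close>, so no other point is efficient, and
  pointedness makes \<open>a\<close> itself efficient.
\<close>

lemma tendsto_scaleR_const_right:
  fixes x :: "'a::real_topological_vector"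
  assumes "(f \<longlongrightarrow> c) G"
  shows "((\<lambda>i. f i *\<^sub>R x) \<longlongrightarrow> c *\<^sub>R x) G"
proof -
  have "LIM i G. (f i, x) :> nhds c \<times>\<^sub>F nhds x"
    using assms by (intro filterlim_Pair) auto
  from filterlim_compose[OF tendsto_scaleR_Pair this] show ?thesis by simp
qed

text \<open>
  The sequence \<open>(x - n k) / n\<close> stays in the cone and converges to \<open>- k\<close>, because \<open>x / n\<close> vanishes
  in the limit.
\<close>

lemma closed_cone_uminus_direction:
  fixes D :: "'a::real_topological_vector set"
  assumes "closed D" "cone D" and line: "\<And>t::real. x + t *\<^sub>R k \<in> D"
  shows "- k \<in> D"
proof (rule Lim_in_closed_set[OF \<open>closed D\<close>])
  show "\<forall>\<^sub>F n in sequentially. inverse (real (Suc n)) *\<^sub>R x - k \<in> D"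
  proof (intro always_eventually allI)
    fix n
    have "inverse (real (Suc n)) *\<^sub>R (x + (- real (Suc n)) *\<^sub>R k) \<in> D"
      using \<open>cone D\<close> line by (intro mem_cone) auto
    moreover have "inverse (real (Suc n)) *\<^sub>R (x + (- real (Suc n)) *\<^sub>R k)
        = inverse (real (Suc n)) *\<^sub>R x - k"
      by (simp only: scaleR_add_right scaleR_scaleR) (simp del: of_nat_Suc)
    ultimately show "inverse (real (Suc n)) *\<^sub>R x - k \<in> D" by simp
  qed
  have "(\<lambda>n. inverse (real (Suc n)) *\<^sub>R x - k) \<longlonglongrightarrow> 0 *\<^sub>R x - k"
    by (intro tendsto_diff tendsto_const tendsto_scaleR_const_right LIMSEQ_inverse_real_of_nat)
  then show "(\<lambda>n. inverse (real (Suc n)) *\<^sub>R x - k) \<longlonglongrightarrow> - k" by simp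
qed simp

lemma mem_translate_neg_iff: "y \<in> translate_neg a D \<longleftrightarrow> a - y \<in> D"
  for a :: "'a::ab_group_add"
  by (force simp: translate_neg_def image_iff algebra_simps)

lemma mem_shifted_translate_neg_iff:
  "y \<in> (\<lambda>z. z + t *\<^sub>R k) ` translate_neg a D \<longleftrightarrow> a + t *\<^sub>R k - y \<in> D"
  for a :: "'a::real_vector"
proof -
  have "y \<in> (\<lambda>z. z + t *\<^sub>R k) ` translate_neg a D \<longleftrightarrow> y - t *\<^sub>R k \<in> translate_neg a D"
    by (force simp: image_iff)
  also have "\<dots> \<longleftrightarrow> a + t *\<^sub>R k - y \<in> D"
    by (simp add: mem_translate_neg_iff diff_diff_eq2)
  finally show ?thesis .
qed

lemma mem_effdom_phi_iff:
  "y \<in> effdom (phi (translate_neg a D) k) \<longleftrightarrow> (\<exists>t. a + t *\<^sub>R k - y \<in> D)"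
  unfolding effdom_phi mem_shifted_translate_neg_iff[symmetric] by auto

lemma phi_on_effdom:
  assumes "y \<in> effdom (phi (translate_neg a D) k)"
  shows "phi (translate_neg a D) k y = Some (INF t\<in>{t. a + t *\<^sub>R k - y \<in> D}. ereal t)"
  using assms by (auto simp: mem_effdom_phi_iff phi_def mem_shifted_translate_neg_iff)

lemma scaleR_direction_mono:
  fixes D :: "'a::real_vector set"
  assumes "convex D" "cone D" "k \<in> D" "s \<le> t" "a + s *\<^sub>R k - y \<in> D"
  shows "a + t *\<^sub>R k - y \<in> D"
proof -
  have "(a + s *\<^sub>R k - y) + (t - s) *\<^sub>R k \<in> D"
    using assms convex_cone[of D] by auto
  then show ?thesis by (simp add: algebra_simps)
qed

text \<open>
  A value at most \<open>t\<close> only gives membership at heights above \<open>t\<close>, arbitrarily close to it; closedness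
  of \<open>D\<close> carries membership over to height \<open>t\<close> itself.
\<close>

lemma phi_le_iff:
  fixes D :: "'a::real_topological_vector set"
  assumes D: "closed D" "convex D" "cone D" "k \<in> D"
    and y: "y \<in> effdom (phi (translate_neg a D) k)"
  shows "the (phi (translate_neg a D) k y) \<le> ereal t \<longleftrightarrow> a + t *\<^sub>R k - y \<in> D"
proof
  assume "a + t *\<^sub>R k - y \<in> D"
  then show "the (phi (translate_neg a D) k y) \<le> ereal t"
    by (auto simp: phi_on_effdom[OF y] intro: INF_lower)
next
  assume le: "the (phi (translate_neg a D) k y) \<le> ereal t"
  have above: "a + u *\<^sub>R k - y \<in> D" if "t < u" for u
  proof -
    have "(INF s\<in>{s. a + s *\<^sub>R k - y \<in> D}. ereal s) < ereal u"
      using le that by (auto simp: phi_on_effdom[OF y] intro: le_less_trans)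
    then obtain s where "a + s *\<^sub>R k - y \<in> D" "s < u"
      by (auto simp: INF_less_iff)
    then show ?thesis
      using D by (intro scaleR_direction_mono[of D k s u]) auto
  qed
  show "a + t *\<^sub>R k - y \<in> D"
  proof (rule Lim_in_closed_set[OF \<open>closed D\<close>])
    show "\<forall>\<^sub>F n in sequentially. a + (t + inverse (real (Suc n))) *\<^sub>R k - y \<in> D"
      by (intro always_eventually allI above) simp
    show "(\<lambda>n. a + (t + inverse (real (Suc n))) *\<^sub>R k - y) \<longlonglongrightarrow> a + t *\<^sub>R k - y"
      by (intro tendsto_diff tendsto_add tendsto_const tendsto_scaleR_const_right
          LIMSEQ_inverse_real_of_nat_add)
  qed simp
qed

text \<open>
  Passing from \<open>y'\<close> to \<open>y \<in> y' - D\<close> enlarges the set over which the infimum is taken,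
  because \<open>D + D \<subseteq> D\<close>.
\<close>

lemma phi_mono:
  assumes "convex D" "cone D" "y' - y \<in> D"
    and y': "y' \<in> effdom (phi (translate_neg a D) k)"
  shows "y \<in> effdom (phi (translate_neg a D) k)"
    and "the (phi (translate_neg a D) k y) \<le> the (phi (translate_neg a D) k y')"
proof -
  have sub: "a + t *\<^sub>R k - y \<in> D" if "a + t *\<^sub>R k - y' \<in> D" for t
  proof -
    have "(a + t *\<^sub>R k - y') + (y' - y) \<in> D"
      using assms that convex_cone[of D] by blast
    then show ?thesis by (simp add: algebra_simps)
  qed
  then show y: "y \<in> effdom (phi (translate_neg a D) k)"
    using y' by (auto simp: mem_effdom_phi_iff)
  show "the (phi (translate_neg a D) k y) \<le> the (phi (translate_neg a D) k y')"
    unfolding phi_on_effdom[OF y] phi_on_effdom[OF y'] option.sel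
    by (rule INF_superset_mono) (use sub in auto)
qed

lemma pointed_uminus_memD: "pointed D \<Longrightarrow> x \<in> D \<Longrightarrow> - x \<in> D \<Longrightarrow> x = 0"
  by (force simp: pointed_def)

lemma proper_phi:
  fixes D :: "'a::real_topological_vector set"
  assumes D: "closed D" "convex D" "cone D" and "pointed D" "k \<in> D - {0}"
  shows "proper_fun (phi (translate_neg a D) k)"
  unfolding proper_fun_def
proof (intro conjI ballI)
  have "a + 1 *\<^sub>R k - a \<in> D" using assms by simp
  then have "a \<in> effdom (phi (translate_neg a D) k)"
    unfolding mem_effdom_phi_iff by blast
  then show "effdom (phi (translate_neg a D) k) \<noteq> {}" by blast
next
  fix y assume y: "y \<in> effdom (phi (translate_neg a D) k)"
  have "phi (translate_neg a D) k y \<noteq> Some (-\<infinity>)"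
  proof
    assume "phi (translate_neg a D) k y = Some (-\<infinity>)"
    then have "a + t *\<^sub>R k - y \<in> D" for t
      using phi_le_iff[OF D _ y, of t] assms(5) by simp
    then have "(a - y) + t *\<^sub>R k \<in> D" for t
      by (simp add: algebra_simps)
    then have "- k \<in> D"
      using D by (intro closed_cone_uminus_direction)
    then show False
      using assms pointed_uminus_memD by blast
  qed
  then show "phi (translate_neg a D) k y \<in> Some ` range ereal"
    using y by (auto simp: effdom_def)
qed

lemma Eff_iff: "y0 \<in> Eff F D \<longleftrightarrow> y0 \<in> F \<and> (\<forall>y\<in>F. y0 - y \<in> D \<longrightarrow> y = y0)"
  for y0 :: "'a::ab_group_add"
  by (auto simp: Eff_def mem_translate_neg_iff)

lemma Eff_least_point:
  assumes "pointed D" and F: "F \<subseteq> (\<lambda>d. a + d) ` D" and "a \<in> F"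
  shows "Eff F D = {a}"
proof -
  have "a - y \<in> D \<Longrightarrow> y = a" if "y \<in> F" for y
    using F that pointed_uminus_memD[OF \<open>pointed D\<close>, of "y - a"] by auto
  moreover have "y0 = a" if "y0 \<in> Eff F D" for y0
    using F that \<open>a \<in> F\<close> by (force simp: Eff_iff)
  ultimately show ?thesis
    using \<open>a \<in> F\<close> by (auto simp: Eff_iff)
qed

lemma strict_phi_minimizer_in_Eff:
  assumes "convex D" "cone D" "y0 \<in> F"
    and "y0 \<in> effdom (phi (translate_neg a D) k)"
    and less: "\<And>y. y \<in> F \<Longrightarrow> y \<in> effdom (phi (translate_neg a D) k) \<Longrightarrow> y \<noteq> y0 \<Longrightarrow>
      the (phi (translate_neg a D) k y0) < the (phi (translate_neg a D) k y)"
  shows "y0 \<in> Eff F D"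
proof -
  have "y = y0" if "y \<in> F" "y0 - y \<in> D" for y
    using phi_mono[OF assms(1,2) that(2) assms(4)] less[OF that(1)] by (meson not_less)
  then show ?thesis
    using \<open>y0 \<in> F\<close> by (simp add: Eff_iff)
qed

text \<open>
  The point \<open>y0\<close> is the vertex of the cone \<open>a - D + 1 \<cdot> k\<close>, which is therefore \<open>y0 - D\<close>.
\<close>

lemma Eff_phi_direction:
  fixes D :: "'a::real_topological_vector set"
  assumes D: "closed D" "convex D" "cone D" and "y0 \<in> Eff F D"
    and k: "k = y0 - a" "k \<in> D"
  shows "y0 \<in> effdom (phi (translate_neg a D) k)"
    and "the (phi (translate_neg a D) k y0) \<le> 1"
    and "\<And>y. y \<in> F \<Longrightarrow> y \<in> effdom (phi (translate_neg a D) k) \<Longrightarrow> y \<noteq> y0 \<Longrightarrow>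
      1 < the (phi (translate_neg a D) k y)"
proof -
  have le_1_iff: "the (phi (translate_neg a D) k y) \<le> 1 \<longleftrightarrow> y0 - y \<in> D"
    if "y \<in> effdom (phi (translate_neg a D) k)" for y
    using phi_le_iff[OF D k(2) that, of 1] by (simp add: k(1) one_ereal_def)
  have "0 \<in> D"
    using D k(2) cone_contains_0 by blast
  then have "a + 1 *\<^sub>R k - y0 \<in> D"
    by (simp add: k(1))
  then show y0: "y0 \<in> effdom (phi (translate_neg a D) k)"
    unfolding mem_effdom_phi_iff by blast
  show "the (phi (translate_neg a D) k y0) \<le> 1"
    using le_1_iff[OF y0] \<open>0 \<in> D\<close> by simp
  show "1 < the (phi (translate_neg a D) k y)"
    if "y \<in> F" "y \<in> effdom (phi (translate_neg a D) k)" "y \<noteq> y0" for y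
    using le_1_iff[OF that(2)] that assms(4) by (auto simp: Eff_iff not_le[symmetric])
qed

theorem theorem10:
  fixes D F :: "'a::real_topological_vector set" and a :: 'a
  assumes "nontrivial_cone D" and "pointed D" and "closed D" and "convex D"
    and "F \<subseteq> (\<lambda>d. a + d) ` D"
  shows "(a \<in> F \<longrightarrow> Eff F D = {a}) \<and>
    (a \<notin> F \<longrightarrow>
      Eff F D =
        {y0 \<in> F. \<exists>k \<in> D - {0}.
          y0 \<in> effdom (phi (translate_neg a D) k) \<and>
          (\<forall>y \<in> (F \<inter> effdom (phi (translate_neg a D) k)) - {y0}.
            the (phi (translate_neg a D) k y0) < the (phi (translate_neg a D) k y))} \<and>
      (\<forall>y0 \<in> Eff F D. \<forall>k. k = y0 - a \<longrightarrow>
        k \<in> D - {0} \<and>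
        y0 \<in> effdom (phi (translate_neg a D) k) \<and>
        the (phi (translate_neg a D) k y0) \<le> 1 \<and>
        (\<forall>y \<in> (F \<inter> effdom (phi (translate_neg a D) k)) - {y0}.
          1 < the (phi (translate_neg a D) k y)) \<and>
        proper_fun (phi (translate_neg a D) k)))"
proof -
  have D: "closed D" "convex D" "cone D"
    using assms by (auto simp: nontrivial_cone_def)
  let ?strict_min = "\<lambda>y0 k. y0 \<in> effdom (phi (translate_neg a D) k) \<and>
    (\<forall>y \<in> (F \<inter> effdom (phi (translate_neg a D) k)) - {y0}.
      the (phi (translate_neg a D) k y0) < the (phi (translate_neg a D) k y))"
  have direction: "y0 - a \<in> D - {0}" if "a \<notin> F" "y0 \<in> Eff F D" for y0
    using that assms(5) by (auto simp: Eff_iff)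
  have "Eff F D = {y0 \<in> F. \<exists>k \<in> D - {0}. ?strict_min y0 k}" if a: "a \<notin> F"
  proof (intro equalityI subsetI)
    fix y0 assume y0: "y0 \<in> Eff F D"
    have k: "y0 - a \<in> D" using direction[OF a y0] by blast
    have "?strict_min y0 (y0 - a)"
      using Eff_phi_direction[OF D y0 refl k] by (auto intro: le_less_trans)
    then show "y0 \<in> {y0 \<in> F. \<exists>k \<in> D - {0}. ?strict_min y0 k}"
      using direction[OF a y0] y0 unfolding Eff_iff by blast
  next
    fix y0 assume "y0 \<in> {y0 \<in> F. \<exists>k \<in> D - {0}. ?strict_min y0 k}"
    then obtain k where "y0 \<in> F" "?strict_min y0 k" by blast
    then show "y0 \<in> Eff F D"
      using D by (intro strict_phi_minimizer_in_Eff[of D y0 F a k]) auto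
  qed
  moreover have "k \<in> D - {0} \<and>
        y0 \<in> effdom (phi (translate_neg a D) k) \<and>
        the (phi (translate_neg a D) k y0) \<le> 1 \<and>
        (\<forall>y \<in> (F \<inter> effdom (phi (translate_neg a D) k)) - {y0}.
          1 < the (phi (translate_neg a D) k y)) \<and>
        proper_fun (phi (translate_neg a D) k)"
    if "a \<notin> F" and y0: "y0 \<in> Eff F D" and k: "k = y0 - a" for y0 k
  proof -
    have kD: "k \<in> D - {0}" using direction that by simp
    then show ?thesis
      using Eff_phi_direction[OF D y0 k] proper_phi[OF D \<open>pointed D\<close> kD] by blast
  qed
  ultimately show ?thesis
    using Eff_least_point[OF \<open>pointed D\<close> assms(5)] by blast
qed

end
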